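(* Let $l<u$ and $b>0$ be fixed, and let $d_1,\dots,d_n$ be i.i.d. $\sim U[l,u]$. Then Michelot's method, applied to $d=(d_1,\dots,d_n)$ and $b$, has an average runtime of $O(n)$; that is, the expected number of elementary operations it performs is $O(n)$ as $n\to\infty$.
   Context: Problem: compute $\mathrm{proj}_{\Delta_b}(d)=\mathrm{argmin}_{v\in\Delta_b}\|v-d\|_2$, where $\Delta_b=\{v\in\mathbb{R}^n:\sum_i v_i=b,\ v\ge0\}$. There is a unique pivot $\tau\in\mathbb{R}$ with $\mathrm{proj}_{\Delta_b}(d)_i=\max\{d_i-\tau,0\}$ for all $i$. Michelot's method: Set $\mathcal{I}_p:=\{1,\dots,n\}$. Repeat: set $\mathcal{I}:=\mathcal{I}_p$; set $p:=(\sum_{i\in\mathcal{I}}d_i-b)/|\mathcal{I}|$; set $\mathcal{I}_p:=\{i\in\mathcal{I}: d_i>p\}$; while $|\mathcal{I}|>|\mathcal{I}_p|$. On termination put $\tau:=p$, $\mathcal{I}_\tau:=\mathcal{I}_p$ and return the sparse vector with entries $d_i-\tau$ for $i\in\mathcal{I}_\tau$ (all other entries being zero). Cost model: each real arithmetic operation, comparison or assignment costs $O(1)$, so one pass of the loop costs $\Theta(|\mathcal{I}|)$. Asymptotics are as $n\to\infty$ with $l,u,b$ fixed (implied constants may depend on $l,u,b$). "Average runtime" means expectation of the operation count over the random input $d$. *)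

theory Defs
  imports "HOL-Probability.Probability" "HOL-Library.Landau_Symbols" "HOL-Library.Monad_Syntax"
begin

text \<open>
  A computation is a pair of its result and the number of elementary operations it has performed.
  The only source of cost is \<open>step\<close>, which stands for a single arithmetic operation, comparison or
  assignment; \<open>ret\<close> merely returns a value that is already available.
\<close>

type_synonym 'a counted = "'a \<times> nat"

definition ret :: "'a \<Rightarrow> 'a counted" where
  "ret x = (x, 0)"

definition step :: "'a \<Rightarrow> 'a counted" where
  "step x = (x, 1)"

definition bind_counted :: "'a counted \<Rightarrow> ('a \<Rightarrow> 'b counted) \<Rightarrow> 'b counted" where
  "bind_counted m f = (fst (f (fst m)), snd m + snd (f (fst m)))"

adhoc_overloading Monad_Syntax.bind \<rightleftharpoons> bind_counted

lemma bind_counted_cong [fundef_cong]: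
  "m = m' \<Longrightarrow> (\<And>x. x = fst m' \<Longrightarrow> f x = g x) \<Longrightarrow> bind_counted m f = bind_counted m' g"
  by (simp add: bind_counted_def)

lemma fst_ret [simp]: "fst (ret x) = x" and snd_ret [simp]: "snd (ret x) = 0"
  by (simp_all add: ret_def)

lemma fst_step [simp]: "fst (step x) = x" and snd_step [simp]: "snd (step x) = 1"
  by (simp_all add: step_def)

lemma fst_bind_counted [simp]: "fst (bind_counted m f) = fst (f (fst m))"
  and snd_bind_counted [simp]: "snd (bind_counted m f) = snd m + snd (f (fst m))"
  by (simp_all add: bind_counted_def)

text \<open>
  Index sets are represented by lists without repetitions. Sets are copied element by element, and
  cardinalities are recomputed by counting, so that no operation on sets is treated as free.
\<close>

fun copy_set :: "nat list \<Rightarrow> nat list counted" where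
  "copy_set [] = ret []"
| "copy_set (i # I) = do { j \<leftarrow> step i; J \<leftarrow> copy_set I; ret (j # J) }"

text \<open>Each round of the next two loops costs one addition and one assignment.\<close>

fun add_entries :: "(nat \<Rightarrow> real) \<Rightarrow> real \<Rightarrow> nat list \<Rightarrow> real counted" where
  "add_entries d s [] = ret s"
| "add_entries d s (i # I) = do { t \<leftarrow> step (s + d i); s' \<leftarrow> step t; add_entries d s' I }"

fun count_elems :: "nat \<Rightarrow> nat list \<Rightarrow> nat counted" where
  "count_elems k [] = ret k"
| "count_elems k (i # I) = do { t \<leftarrow> step (k + 1); k' \<leftarrow> step t; count_elems k' I }"

fun select_above :: "(nat \<Rightarrow> real) \<Rightarrow> real \<Rightarrow> nat list \<Rightarrow> nat list counted" where
  "select_above d p [] = ret []"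
| "select_above d p (i # I) = do {
     above \<leftarrow> step (d i > p);
     J \<leftarrow> select_above d p I;
     if above then do { j \<leftarrow> step i; ret (j # J) } else ret J }"

fun sparse_entries :: "(nat \<Rightarrow> real) \<Rightarrow> real \<Rightarrow> nat list \<Rightarrow> (nat \<times> real) list counted" where
  "sparse_entries d \<tau> [] = ret []"
| "sparse_entries d \<tau> (i # I) = do {
     t \<leftarrow> step (d i - \<tau>);
     e \<leftarrow> step (i, t);
     es \<leftarrow> sparse_entries d \<tau> I;
     ret (e # es) }"

text \<open>
  One execution of the loop body, started with the current value of $\mathcal{I}_p$. It returns the
  new $p$, the new $\mathcal{I}_p$ and the outcome of the loop test $|\mathcal{I}| > |\mathcal{I}_p|$.
  If $b > 0$ and the first index set is nonempty, then so are all later ones, since $p$ is smaller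
  than the mean of the current entries; hence $k = 0$ occurs only for $n = 0$.
\<close>

definition michelot_pass ::
    "(nat \<Rightarrow> real) \<Rightarrow> real \<Rightarrow> nat list \<Rightarrow> (real \<times> nat list \<times> bool) counted" where
  "michelot_pass d b I\<^sub>p = do {
     I \<leftarrow> copy_set I\<^sub>p;
     s\<^sub>0 \<leftarrow> step 0;
     s \<leftarrow> add_entries d s\<^sub>0 I;
     k\<^sub>0 \<leftarrow> step 0;
     k \<leftarrow> count_elems k\<^sub>0 I;
     t \<leftarrow> step (s - b);
     q \<leftarrow> step (t / real k);
     p \<leftarrow> step q;
     J \<leftarrow> select_above d p I;
     m\<^sub>0 \<leftarrow> step 0;
     m \<leftarrow> count_elems m\<^sub>0 J;
     continue \<leftarrow> step (k > m);
     ret (p, J, continue) }"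

lemma fst_copy_set [simp]: "fst (copy_set I) = I"
  by (induction I) simp_all

lemma snd_copy_set [simp]: "snd (copy_set I) = length I"
  by (induction I) simp_all

lemma fst_add_entries [simp]: "fst (add_entries d s I) = s + (\<Sum>i\<leftarrow>I. d i)"
  by (induction I arbitrary: s) simp_all

lemma snd_add_entries [simp]: "snd (add_entries d s I) = 2 * length I"
  by (induction I arbitrary: s) simp_all

lemma fst_count_elems [simp]: "fst (count_elems k I) = k + length I"
  by (induction I arbitrary: k) simp_all

lemma snd_count_elems [simp]: "snd (count_elems k I) = 2 * length I"
  by (induction I arbitrary: k) simp_all

lemma fst_select_above [simp]: "fst (select_above d p I) = filter (\<lambda>i. d i > p) I"
  by (induction I) simp_all

lemma snd_select_above [simp]:
  "snd (select_above d p I) = length I + length (filter (\<lambda>i. d i > p) I)"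
  by (induction I) simp_all

lemma fst_sparse_entries [simp]: "fst (sparse_entries d \<tau> I) = map (\<lambda>i. (i, d i - \<tau>)) I"
  by (induction I) simp_all

lemma snd_sparse_entries [simp]: "snd (sparse_entries d \<tau> I) = 2 * length I"
  by (induction I) simp_all

lemma fst_michelot_pass:
  "fst (michelot_pass d b I) =
     (let p = ((\<Sum>i\<leftarrow>I. d i) - b) / real (length I); J = filter (\<lambda>i. d i > p) I
      in (p, J, length I > length J))"
  by (simp add: michelot_pass_def Let_def)

lemma snd_michelot_pass:
  "snd (michelot_pass d b I) =
     6 * length I + 3 * length (filter (\<lambda>i. d i > ((\<Sum>i\<leftarrow>I. d i) - b) / real (length I)) I) + 7"
  by (simp add: michelot_pass_def)

function michelot_loop :: "(nat \<Rightarrow> real) \<Rightarrow> real \<Rightarrow> nat list \<Rightarrow> (real \<times> nat list) counted" where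
  "michelot_loop d b I\<^sub>p = do {
     (p, J, continue) \<leftarrow> michelot_pass d b I\<^sub>p;
     if continue then michelot_loop d b J else ret (p, J) }"
  by pat_completeness auto
termination
  by (relation "Wellfounded.measure (\<lambda>(d, b, I). length I)") (auto simp: fst_michelot_pass Let_def)

declare michelot_loop.simps [simp del]

text \<open>
  The input vector is \<open>(d 1, \<dots>, d n)\<close>; the output lists the indices in $\mathcal{I}_\tau$ together
  with the corresponding entries.
\<close>

definition michelot :: "nat \<Rightarrow> (nat \<Rightarrow> real) \<Rightarrow> real \<Rightarrow> (nat \<times> real) list counted" where
  "michelot n d b = do {
     I\<^sub>p \<leftarrow> copy_set [1..<n + 1];
     (\<tau>, I\<^sub>\<tau>) \<leftarrow> michelot_loop d b I\<^sub>p;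
     sparse_entries d \<tau> I\<^sub>\<tau> }"

definition michelot_ops :: "nat \<Rightarrow> (nat \<Rightarrow> real) \<Rightarrow> real \<Rightarrow> nat" where
  "michelot_ops n d b = snd (michelot n d b)"

end

theory Submission
  imports Defs
begin

text \<open>
  Put $L = u - l$, $N_j = |\{i : d_i > u - L/2^j\}|$, $\mu_j = n/2^j$ and $D_j = N_j - \mu_j$.
  As every pass but the last removes an index, a run that has come down to $m$ indices costs only
  $O(m^2)$ more. Let $K$ be least with $n L < 64 b 4^K$, so that $\mu_K^2 = O(n)$. While $p$ lies
  between $u - L/2^j$ and $u - L/2^{j+1}$ for some $j < K$, either $N_j$ and $N_{j+2}$ are close to
  $\mu_j$ and $\mu_{j+2}$, in which case every pass costs $O(\mu_j)$ and raises $p$ by a fixed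
  fraction of $L/2^j$, so that boundedly many passes suffice to leave this range; or
  $\mu_j^2 = O(D_j^2 + D_{j+2}^2)$, and the quadratic bound $O(N_j^2)$ pays for the whole rest of
  the run. Hence the cost is at most a constant times
  $1 + n + \sum_{j<K} (\mu_j + D_j^2 + D_{j+2}^2) + \mu_K^2 + D_K^2$ pointwise, and
  $\mathrm{E} D_j^2 \le \mu_j$ finishes the proof.
\<close>

section \<open>A pointwise bound on the cost\<close>

text \<open>The last summand is the cost of writing the output.\<close>

definition loop_ops :: "(nat \<Rightarrow> real) \<Rightarrow> real \<Rightarrow> nat list \<Rightarrow> nat" where
  "loop_ops d b I = snd (michelot_loop d b I) + 2 * length (snd (fst (michelot_loop d b I)))"

lemma michelot_ops_eq: "michelot_ops n d b = n + loop_ops d b [1..<n + 1]"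
  by (simp add: michelot_ops_def michelot_def loop_ops_def case_prod_beta del: upt_Suc)

text \<open>The intermediate \<open>p\<close> of a single pass, not yet the final \<tau>. On the
  empty list, division by zero makes it 0.\<close>

definition pivot :: "(nat \<Rightarrow> real) \<Rightarrow> real \<Rightarrow> nat list \<Rightarrow> real" where
  "pivot d b I = ((\<Sum>i\<leftarrow>I. d i) - b) / real (length I)"

text \<open>In the cost estimates \<open>I\<close> is a fixed list, and a state of the run is
  encoded by the threshold \<open>p\<close> alone.\<close>

definition indices_above :: "(nat \<Rightarrow> real) \<Rightarrow> real \<Rightarrow> nat list \<Rightarrow> nat list" where
  "indices_above d p I = filter (\<lambda>i. d i > p) I"

lemma length_indices_above_le: "length (indices_above d p I) \<le> length I"
  by (simp add: indices_above_def)

lemma length_indices_above_antimono: "p \<le> q \<Longrightarrow> length (indices_above d q I) \<le> length (indices_above d p I)"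
  unfolding indices_above_def by (induction I) auto

text \<open>Merges the nested selections of successive passes into one selection from the original
  list, as long as the thresholds do not decrease.\<close>

lemma indices_above_twice: "p \<le> q \<Longrightarrow> indices_above d q (indices_above d p I) = indices_above d q I"
  unfolding indices_above_def by (induction I) auto

lemma loop_ops_rec:
  "loop_ops d b I =
     (let J = indices_above d (pivot d b I) I
      in 6 * length I + 3 * length J + 7 +
         (if length J < length I then loop_ops d b J else 2 * length J))"
  using michelot_loop.simps[of d b I]
  by (simp add: loop_ops_def case_prod_beta fst_michelot_pass snd_michelot_pass Let_def
      indices_above_def pivot_def)

text \<open>A continuing pass on \<open>m + 1\<close> indices leaves at most \<open>m\<close> and
  costs at most \<open>9 * m + 13\<close>, less than the increment \<open>18 * (2 * m + 1)\<close>
  of the bound. A final pass with its output costs at most \<open>11 * length I + 7\<close>.\<close>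

lemma loop_ops_le_square: "loop_ops d b I \<le> 7 + 18 * (length I)\<^sup>2"
proof (induction "length I" arbitrary: I rule: less_induct)
  case less
  define J where "J = indices_above d (pivot d b I) I"
  have J: "length J \<le> length I"
    by (simp add: J_def length_indices_above_le)
  have rec: "loop_ops d b I = 6 * length I + 3 * length J + 7 +
      (if length J < length I then loop_ops d b J else 2 * length J)"
    by (subst loop_ops_rec) (simp add: J_def Let_def)
  show ?case
  proof (cases "length J < length I")
    case True
    then obtain m where m: "length I = Suc m"
      by (cases "length I") auto
    have "loop_ops d b J \<le> 7 + 18 * (length J)\<^sup>2"
      using less True by blast
    moreover have "(length J)\<^sup>2 \<le> m\<^sup>2"
      using True m by (intro power_mono) auto
    ultimately show ?thesis
      using rec True m by (simp add: power2_eq_square)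
  next
    case False
    have "length I \<le> (length I)\<^sup>2"
      by (simp add: power2_nat_le_imp_le le_square power2_eq_square)
    with rec J False show ?thesis by simp
  qed
qed

text \<open>The factor 11 is 6 + 3 for the pass and 2 for the output, so that a final pass is
  covered as well as a continuing one.\<close>

lemma loop_ops_pass_le:
  assumes "p \<le> pivot d b (indices_above d p I)"
  shows "loop_ops d b (indices_above d p I) \<le>
    11 * length (indices_above d p I) + 7 + loop_ops d b (indices_above d (pivot d b (indices_above d p I)) I)"
proof -
  define q where "q = pivot d b (indices_above d p I)"
  have "indices_above d q (indices_above d p I) = indices_above d q I"
    using assms by (simp add: indices_above_twice q_def)
  moreover have "length (indices_above d q I) \<le> length (indices_above d p I)"
    using assms by (simp add: length_indices_above_antimono q_def)
  ultimately show ?thesis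
    by (subst loop_ops_rec) (simp add: Let_def flip: q_def)
qed

section \<open>Progress of the pivot within one dyadic range\<close>

lemma excess_ge:
  assumes "p \<le> q"
  shows "(q - p) * real (length (indices_above d q I)) \<le> (\<Sum>i\<leftarrow>indices_above d p I. d i) - p * real (length (indices_above d p I))"
  using assms unfolding indices_above_def by (induction I) (auto simp: algebra_simps)

text \<open>The gain of the new pivot over \<open>p\<close> is the sum of \<open>d i - p\<close>
  over the current indices, minus \<open>b\<close>, divided by their number. By
  \<open>excess_ge\<close> that sum is at least \<open>q - p\<close> for each entry above
  \<open>q\<close>.\<close>

lemma pivot_ge:
  assumes "p \<le> q" and "length (indices_above d p I) > 0"
    and "\<delta> * real (length (indices_above d p I)) + b \<le> (q - p) * real (length (indices_above d q I))"
  shows "p + \<delta> \<le> pivot d b (indices_above d p I)"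
  using excess_ge[OF assms(1), of d I] assms(2,3)
  by (simp add: pivot_def le_divide_eq algebra_simps del: length_greater_0_conv)

text \<open>While \<open>p\<close> is below \<open>u - L / 2 ^ (j + 1)\<close>, the entries above
  \<open>u - L / 2 ^ (j + 2)\<close> exceed it by at least \<open>L / 2 ^ (j + 2)\<close>, which
  forces progress; this is why scale \<open>j + 2\<close> enters. A pass may jump over several
  ranges, so \<open>R\<close> has to bound the cost from every larger \<open>p\<close>. The constant
  is 1296 = 48 * 27.\<close>

lemma loop_ops_scale_step:
  fixes n L :: real and I :: "nat list"
  assumes "L > 0" and "b > 0" and "n \<ge> 0" and large: "64 * b * 4 ^ j \<le> n * L"
    and dev: "\<bar>real (length (indices_above d (u - L / 2 ^ j) I)) - n / 2 ^ j\<bar> \<le> n / 2 ^ j / 2"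
    and dev': "\<bar>real (length (indices_above d (u - L / 2 ^ (j + 2)) I)) - n / 2 ^ (j + 2)\<bar> \<le> n / 2 ^ (j + 2) / 2"
    and rest: "\<And>p. u - L / 2 ^ (j + 1) \<le> p \<Longrightarrow> real (loop_ops d b (indices_above d p I)) \<le> R"
    and p: "u - L / 2 ^ j \<le> p"
  shows "real (loop_ops d b (indices_above d p I)) \<le> 1296 * (n / 2 ^ j) + R"
proof -
  define t \<mu> where "t = L / 2 ^ j" and "\<mu> = n / 2 ^ j"
  have "n > 0"
  proof -
    have "0 < 64 * b * 4 ^ j" using assms by simp
    with large have "0 < n * L" by linarith
    with \<open>L > 0\<close> show ?thesis by (simp add: zero_less_mult_iff)
  qed
  then have pos: "t > 0" "\<mu> > 0" using \<open>L > 0\<close> by (auto simp: t_def \<mu>_def)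
  \<comment> \<open>The subtraction of \<open>b\<close> is harmless at this scale: \<open>b\<close>
    is at most 1/64 of reference count times width.\<close>
  have b: "64 * b \<le> \<mu> * t"
  proof -
    have "\<mu> * t = n * L / 4 ^ j"
      by (simp add: \<mu>_def t_def flip: power_mult_distrib)
    with large show ?thesis by (simp add: le_divide_eq)
  qed
  have N: "real (length (indices_above d (u - t) I)) \<le> 3 / 2 * \<mu>"
    using dev unfolding t_def[symmetric] \<mu>_def[symmetric] abs_le_iff by linarith
  have quarter: "L / 2 ^ (j + 2) = t / 4" "n / 2 ^ (j + 2) = \<mu> / 4"
    by (auto simp: t_def \<mu>_def)
  have N': "\<mu> / 8 \<le> real (length (indices_above d (u - t / 4) I))"
    using dev' unfolding quarter abs_le_iff by linarith
  have t2: "L / 2 ^ (j + 1) = t / 2" by (simp add: t_def)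
  \<comment> \<open>A pass costs at most $18 N_j \le 27 \mu_j$ and raises $p$ by at least $t/96$; this range has
    width $t/2$, hence takes at most 48 passes.\<close>
  have "real (loop_ops d b (indices_above d p I)) \<le> 27 * \<mu> * real m + R"
    if "u - t \<le> p" "u - t / 2 - real m * (t / 96) \<le> p" for p m
    using that
  \<comment> \<open>\<open>m\<close> bounds the number of passes made before \<open>p\<close>
    reaches \<open>u - t / 2\<close>.\<close>
  proof (induction m arbitrary: p)
    case 0
    then show ?case using rest[of p] t2 by simp
  next
    case (Suc m)
    show ?case
    proof (cases "u - t / 2 \<le> p")
      case True
      then have "real (loop_ops d b (indices_above d p I)) \<le> R" using rest[of p] t2 by simp
      moreover have "0 \<le> 27 * \<mu> * real (Suc m)" using pos by simp
      ultimately show ?thesis by linarith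
    next
      case False
      define k where "k = length (indices_above d p I)"
      have "length (indices_above d (u - t / 4) I) \<le> k"
        unfolding k_def using False pos by (intro length_indices_above_antimono) auto
      with N' pos have "real k > 0" by linarith
      then have k: "k > 0" by simp
      have "k \<le> length (indices_above d (u - t) I)"
        unfolding k_def using Suc.prems by (intro length_indices_above_antimono) auto
      with N have kN: "real k \<le> 3 / 2 * \<mu>" by linarith
      \<comment> \<open>Choice of 96: a gain of \<open>t / 96\<close> for up to
        \<open>3 / 2 * \<mu>\<close> indices uses \<mu>t/64, and \<open>b\<close> uses at most as
        much. Together this is \<mu>t/32, the excess guaranteed by the \<mu>/8 entries above
        \<open>u - t / 4\<close>.\<close>
      have "t / 96 * real k \<le> t / 96 * (3 / 2 * \<mu>)"
        using kN pos by (intro mult_left_mono) auto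
      also have "\<dots> = \<mu> * t / 64" by simp
      finally have "t / 96 * real k + b \<le> \<mu> * t / 32"
        using b by linarith
      also have "\<mu> * t / 32 = t / 4 * (\<mu> / 8)" by simp
      also have "\<dots> \<le> (u - t / 4 - p) * real (length (indices_above d (u - t / 4) I))"
        using False N' pos by (intro mult_mono) auto
      finally have "p + t / 96 \<le> pivot d b (indices_above d p I)"
        using k False pos
        by (intro pivot_ge[where q = "u - t / 4"]) (auto simp: k_def)
      moreover from this Suc.prems
      have "real (loop_ops d b (indices_above d (pivot d b (indices_above d p I)) I)) \<le> 27 * \<mu> * real m + R"
      proof (intro Suc.IH)
        have "real (Suc m) * (t / 96) = real m * (t / 96) + t / 96"
          by (simp add: distrib_right)
        with \<open>p + t / 96 \<le> pivot d b (indices_above d p I)\<close> Suc.prems pos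
        show "u - t \<le> pivot d b (indices_above d p I)"
          and "u - t / 2 - real m * (t / 96) \<le> pivot d b (indices_above d p I)"
          by linarith+
      qed
      moreover have "loop_ops d b (indices_above d p I) \<le>
          11 * k + 7 + loop_ops d b (indices_above d (pivot d b (indices_above d p I)) I)"
        using calculation(1) pos unfolding k_def by (intro loop_ops_pass_le) auto
      ultimately have "real (loop_ops d b (indices_above d p I)) \<le> 11 * real k + 7 + (27 * \<mu> * real m + R)"
        by linarith
      \<comment> \<open>Since \<open>k\<close> is at least 1, \<open>11 * k + 7\<close> is at most
        \<open>18 * k\<close>, hence at most \<open>27 * \<mu>\<close>.\<close>
      then show ?thesis
        using k kN by (simp add: algebra_simps)
    qed
  qed
  from this[of p 48] p show ?thesis
    by (simp add: t_def \<mu>_def)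
qed

section \<open>Summation over the dyadic ranges\<close>

lemma loop_ops_le_square_deviation:
  fixes n :: real
  assumes "u - L / 2 ^ j \<le> p"
  shows "real (loop_ops d b (indices_above d p I)) \<le>
    7 + 36 * ((n / 2 ^ j)\<^sup>2 + (real (length (indices_above d (u - L / 2 ^ j) I)) - n / 2 ^ j)\<^sup>2)"
proof -
  define N \<mu> where "N = real (length (indices_above d (u - L / 2 ^ j) I))" and "\<mu> = n / 2 ^ j"
  have "real (loop_ops d b (indices_above d p I)) \<le> 7 + 18 * (real (length (indices_above d p I)))\<^sup>2"
    using of_nat_mono[OF loop_ops_le_square, of d b "indices_above d p I", where 'a = real] by simp
  also have "(real (length (indices_above d p I)))\<^sup>2 \<le> N\<^sup>2"
    using length_indices_above_antimono[OF assms, of d I] by (intro power_mono) (auto simp: N_def)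
  \<comment> \<open>The difference of the two sides is
    \<open>(2 * \<mu> - N)\<^sup>2\<close>.\<close>
  also have "N\<^sup>2 \<le> 2 * (\<mu>\<^sup>2 + (N - \<mu>)\<^sup>2)"
    using zero_le_power2[of "2 * \<mu> - N"] by (simp add: power2_eq_square algebra_simps)
  finally show ?thesis
    by (simp add: N_def \<mu>_def)
qed

text \<open>Induction from scale \<open>K\<close> down to \<open>i\<close>. At \<open>K\<close> the
  quadratic bound is used outright; at a smaller scale either both counts are accurate and one range
  is paid for, or a deviation pays for the whole remaining run.\<close>

lemma loop_ops_le_deviations:
  fixes n L u :: real and I :: "nat list" and d :: "nat \<Rightarrow> real"
  defines "D \<equiv> \<lambda>j. real (length (indices_above d (u - L / 2 ^ j) I)) - n / 2 ^ j"
  assumes "L > 0" and "b > 0" and "n \<ge> 0" and large: "\<And>j. j < K \<Longrightarrow> 64 * b * 4 ^ j \<le> n * L"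
    and "i \<le> K" and "u - L / 2 ^ i \<le> p"
  shows "real (loop_ops d b (indices_above d p I)) \<le> 7 + 36 * ((n / 2 ^ K)\<^sup>2 + (D K)\<^sup>2) +
    (\<Sum>j=i..<K. 1296 * (n / 2 ^ j) + 2304 * ((D j)\<^sup>2 + (D (j + 2))\<^sup>2))"
  using \<open>i \<le> K\<close> \<open>u - L / 2 ^ i \<le> p\<close>
proof (induction i arbitrary: p rule: inc_induct)
  case base
  then show ?case using loop_ops_le_square_deviation[OF base(1), of d b I n]
    by (simp add: D_def)
next
  case (step i)
  define \<mu> where "\<mu> = n / 2 ^ i"
  define S where "S = 7 + 36 * ((n / 2 ^ K)\<^sup>2 + (D K)\<^sup>2) +
    (\<Sum>j=Suc i..<K. 1296 * (n / 2 ^ j) + 2304 * ((D j)\<^sup>2 + (D (j + 2))\<^sup>2))"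
  have "\<mu> \<ge> 0"
    using \<open>n \<ge> 0\<close> by (simp add: \<mu>_def)
  have "S \<ge> 7"
    using \<open>n \<ge> 0\<close> by (auto simp: S_def intro!: add_nonneg_nonneg sum_nonneg)
  have "real (loop_ops d b (indices_above d p I)) \<le> 1296 * \<mu> + 2304 * ((D i)\<^sup>2 + (D (i + 2))\<^sup>2) + S"
  \<comment> \<open>The tolerances are half the reference counts at scales \<open>i\<close> and
    \<open>i + 2\<close>, as \<open>loop_ops_scale_step\<close> demands.\<close>
  proof (cases "\<bar>D i\<bar> \<le> \<mu> / 2 \<and> \<bar>D (i + 2)\<bar> \<le> \<mu> / 8")
    case True
    have "real (loop_ops d b (indices_above d p I)) \<le> 1296 * \<mu> + S"
      unfolding \<mu>_def
      by (rule loop_ops_scale_step[OF \<open>L > 0\<close> \<open>b > 0\<close> \<open>n \<ge> 0\<close> large[OF step(2)]])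
        (use True step in \<open>auto simp: D_def \<mu>_def S_def\<close>)
    moreover have "0 \<le> 2304 * ((D i)\<^sup>2 + (D (i + 2))\<^sup>2)"
      by simp
    ultimately show ?thesis by linarith
  next
    case False
    \<comment> \<open>A large deviation dominates \<mu>, so the quadratic bound turns into squared
      deviations with factor at most 2304 = 36 * 64; its constant 7 is absorbed by
      \<open>S\<close>.\<close>
    then have "\<bar>\<mu>\<bar> \<le> \<bar>2 * D i\<bar> \<or> \<bar>\<mu>\<bar> \<le> \<bar>8 * D (i + 2)\<bar>"
      using \<open>\<mu> \<ge> 0\<close> by (auto simp: abs_mult)
    then have "\<mu>\<^sup>2 \<le> (2 * D i)\<^sup>2 \<or> \<mu>\<^sup>2 \<le> (8 * D (i + 2))\<^sup>2"
      unfolding abs_le_square_iff .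
    then have "\<mu>\<^sup>2 \<le> 4 * (D i)\<^sup>2 + 64 * (D (i + 2))\<^sup>2"
      by (rule disjE) (simp_all add: power_mult_distrib add_increasing add_increasing2)
    moreover have "real (loop_ops d b (indices_above d p I)) \<le> 7 + 36 * (\<mu>\<^sup>2 + (D i)\<^sup>2)"
      using loop_ops_le_square_deviation[OF step.prems, of d b I n] by (simp add: D_def \<mu>_def)
    ultimately show ?thesis
      using \<open>\<mu> \<ge> 0\<close> \<open>S \<ge> 7\<close> zero_le_power2[of "D i"] zero_le_power2[of "D (i + 2)"] by argo
  qed
  then show ?case
    using step(2) by (simp add: S_def \<mu>_def sum.atLeast_Suc_lessThan)
qed

section \<open>Measurability of the cost\<close>

lemma measurable_filter_list:
  assumes "\<And>i. i \<in> set I \<Longrightarrow> Measurable.pred M (P i)"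
  shows "(\<lambda>\<omega>. filter (\<lambda>i. P i \<omega>) I) \<in> measurable M (count_space UNIV)"
  using assms
proof (induction I)
  case Nil
  then show ?case by simp
next
  case (Cons i I)
  have P: "Measurable.pred M (P i)"
    and IH: "(\<lambda>\<omega>. filter (\<lambda>i. P i \<omega>) I) \<in> measurable M (count_space UNIV)"
    using Cons by auto
  show ?case
    unfolding filter.simps
    by (intro measurable_If IH measurable_compose[OF IH] P[unfolded pred_def]) auto
qed

lemma measurable_indices_above:
  assumes [measurable]: "\<And>i. i \<in> set I \<Longrightarrow> d i \<in> borel_measurable M" "p \<in> borel_measurable M"
  shows "(\<lambda>\<omega>. indices_above (\<lambda>i. d i \<omega>) (p \<omega>) I) \<in> measurable M (count_space UNIV)"
  unfolding indices_above_def by (intro measurable_filter_list) measurable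

lemma measurable_pivot:
  assumes "\<And>i. i \<in> set I \<Longrightarrow> d i \<in> borel_measurable M"
  shows "(\<lambda>\<omega>. pivot (\<lambda>i. d i \<omega>) b I) \<in> borel_measurable M"
proof -
  have "(\<lambda>\<omega>. \<Sum>i\<leftarrow>I. d i \<omega>) \<in> borel_measurable M"
    using assms by (induction I) auto
  then show ?thesis
    unfolding pivot_def by measurable
qed

text \<open>The index list left by the first pass takes values in a countable type. For each fixed
  shorter list the cost is measurable by induction, and \<open>measurable_compose_countable\<close>
  glues these functions along the random list.\<close>

lemma measurable_loop_ops:
  assumes "\<And>i. i \<in> set I \<Longrightarrow> d i \<in> borel_measurable M"
  shows "(\<lambda>\<omega>. loop_ops (\<lambda>i. d i \<omega>) b I) \<in> measurable M (count_space UNIV)"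
  using assms
proof (induction "length I" arbitrary: I rule: less_induct)
  case less
  define J where "J \<omega> = indices_above (\<lambda>i. d i \<omega>) (pivot (\<lambda>i. d i \<omega>) b I) I" for \<omega>
  \<comment> \<open>The guard on \<open>set J'\<close> always holds for the actual list
    \<open>J \<omega>\<close>; for other lists \<open>d\<close> is not assumed measurable, so
    \<open>h\<close> takes a constant value there.\<close>
  define h where "h J' \<omega> = 6 * length I + 3 * length J' + 7 +
      (if length J' < length I \<and> set J' \<subseteq> set I then loop_ops (\<lambda>i. d i \<omega>) b J' else 2 * length J')"
    for J' \<omega>
  have eq: "loop_ops (\<lambda>i. d i \<omega>) b I = h (J \<omega>) \<omega>" for \<omega>
    using loop_ops_rec[of "\<lambda>i. d i \<omega>" b I] by (simp add: h_def J_def Let_def indices_above_def)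
  have "(\<lambda>\<omega>. h J' \<omega>) \<in> measurable M (count_space UNIV)" for J'
  proof (cases "length J' < length I \<and> set J' \<subseteq> set I")
    case True
    then have [measurable]: "(\<lambda>\<omega>. loop_ops (\<lambda>i. d i \<omega>) b J') \<in> measurable M (count_space UNIV)"
      by (intro less) auto
    show ?thesis
      unfolding h_def using True by simp
  next
    case False
    then show ?thesis
      unfolding h_def if_not_P[OF False] by simp
  qed
  moreover have "J \<in> measurable M (count_space UNIV)"
    unfolding J_def using less(2) by (intro measurable_indices_above measurable_pivot)
  ultimately show ?case
    unfolding eq by (rule measurable_compose_countable)
qed

section \<open>Expected cost\<close>

text \<open>The mixed products vanish in expectation by independence and centring. Integrability is
  carried along because the induction needs it.\<close>

lemma (in prob_space) expectation_square_sum_indep: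
  fixes Y :: "'i \<Rightarrow> 'a \<Rightarrow> real"
  assumes "finite I" and "indep_vars (\<lambda>_. borel) Y I"
    and "\<And>i. i \<in> I \<Longrightarrow> integrable M (\<lambda>\<omega>. (Y i \<omega>)\<^sup>2)"
    and "\<And>i. i \<in> I \<Longrightarrow> expectation (Y i) = 0"
  shows "integrable M (\<lambda>\<omega>. (\<Sum>i\<in>I. Y i \<omega>)\<^sup>2) \<and>
    expectation (\<lambda>\<omega>. (\<Sum>i\<in>I. Y i \<omega>)\<^sup>2) = (\<Sum>i\<in>I. expectation (\<lambda>\<omega>. (Y i \<omega>)\<^sup>2))"
  using assms
proof (induction I rule: finite_induct)
  case empty
  then show ?case by simp
next
  case (insert i I)
  define S where "S \<omega> = (\<Sum>j\<in>I. Y j \<omega>)" for \<omega>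
  have ind: "indep_vars (\<lambda>_. borel) Y I"
    using insert.prems(1) by (rule indep_vars_subset) auto
  have IH: "integrable M (\<lambda>\<omega>. (S \<omega>)\<^sup>2)"
      "expectation (\<lambda>\<omega>. (S \<omega>)\<^sup>2) = (\<Sum>j\<in>I. expectation (\<lambda>\<omega>. (Y j \<omega>)\<^sup>2))"
    using insert.IH[OF ind] insert.prems by (auto simp: S_def)
  have rv: "random_variable borel (Y j)" if "j \<in> insert i I" for j
    using insert.prems(1) that by (auto simp: indep_vars_def)
  have int: "integrable M (Y j)" if "j \<in> insert i I" for j
    using square_integrable_imp_integrable[OF rv[OF that]] insert.prems(2)[OF that] by simp
  have intS: "integrable M S"
    unfolding S_def using int by (intro Bochner_Integration.integrable_sum) auto
  have indS: "indep_var borel (Y i) borel S"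
    unfolding S_def using insert by (intro indep_vars_sum) auto
  have "expectation (Y i) = 0"
    using insert.prems(3) by simp
  then have mixed: "integrable M (\<lambda>\<omega>. Y i \<omega> * S \<omega>)" "expectation (\<lambda>\<omega>. Y i \<omega> * S \<omega>) = 0"
    using indep_var_integrable[OF indS] indep_var_lebesgue_integral[OF indS] int intS by auto
  have Yi: "integrable M (\<lambda>\<omega>. (Y i \<omega>)\<^sup>2)"
    using insert.prems(2) by simp
  have eq: "(\<Sum>j\<in>insert i I. Y j \<omega>)\<^sup>2 = (Y i \<omega>)\<^sup>2 + 2 * (Y i \<omega> * S \<omega>) + (S \<omega>)\<^sup>2" for \<omega>
    using insert.hyps by (simp add: S_def power2_sum)
  show ?case
    unfolding eq using mixed Yi IH insert.hyps by simp
qed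

lemma (in prob_space) prob_uniform_upper_tail:
  fixes X :: "'a \<Rightarrow> real"
  assumes "l < u" and [measurable]: "random_variable borel X"
    and "distr M borel X = uniform_measure lborel {l..u}" and "0 \<le> t" "t \<le> u - l"
  shows "\<P>(\<omega> in M. u - t < X \<omega>) = t / (u - l)"
proof -
  have "\<P>(\<omega> in M. u - t < X \<omega>) = measure (distr M borel X) {u - t<..}"
    by (simp add: measure_distr vimage_def Int_def conj_commute)
  also have "\<dots> = measure lborel ({l..u} \<inter> {u - t<..}) / measure lborel {l..u}"
    unfolding assms(3) using assms(1) by (subst measure_uniform_measure) auto
  also have "{l..u} \<inter> {u - t<..} = {u - t<..u}"
    using assms by auto
  finally show ?thesis
    using assms by simp
qed

text \<open>The count is binomial with success probability \<open>q = t / (u - l)\<close>, so its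
  variance \<open>n * q * (1 - q)\<close> is at most its mean. This makes the squared deviations sum
  to O(n) over the dyadic scales.\<close>

lemma (in prob_space) uniform_count_deviation:
  fixes X :: "nat \<Rightarrow> 'a \<Rightarrow> real"
  assumes "l < u" and ind: "indep_vars (\<lambda>_. borel) X {1..n}"
    and unif: "\<And>i. i \<in> {1..n} \<Longrightarrow> distr M borel (X i) = uniform_measure lborel {l..u}"
    and t: "0 \<le> t" "t \<le> u - l"
  defines "D \<equiv> \<lambda>\<omega>. real (length (indices_above (\<lambda>i. X i \<omega>) (u - t) [1..<n + 1])) - real n * (t / (u - l))"
  shows "integrable M (\<lambda>\<omega>. (D \<omega>)\<^sup>2)" and "expectation (\<lambda>\<omega>. (D \<omega>)\<^sup>2) \<le> real n * (t / (u - l))"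
proof -
  define q where "q = t / (u - l)"
  define B where "B i \<omega> = (indicator {u - t<..} (X i \<omega>) :: real)" for i \<omega>
  define Y where "Y i \<omega> = B i \<omega> - q" for i \<omega>
  have rv: "random_variable borel (X i)" if "i \<in> {1..n}" for i
    using ind that by (auto simp: indep_vars_def)
  have B_eq: "B i = indicator {\<omega>. u - t < X i \<omega>}" for i
    by (auto simp: B_def fun_eq_iff split: split_indicator)
  have B: "integrable M (B i)" "expectation (B i) = q" if "i \<in> {1..n}" for i
  proof -
    note [measurable] = rv[OF that]
    show "integrable M (B i)"
      unfolding B_def
      by (rule integrable_const_bound[where B = 1]) (auto split: split_indicator)
    show "expectation (B i) = q"
      using prob_uniform_upper_tail[OF \<open>l < u\<close> rv[OF that] unif[OF that] t]
      by (simp add: B_eq q_def Int_def conj_commute)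
  qed
  \<comment> \<open>\<open>B i\<close> is its own square, having only the values 0 and 1; in
    expectation this gives \<open>q - q\<^sup>2\<close>.\<close>
  have Y2: "(Y i \<omega>)\<^sup>2 = (1 - 2 * q) * B i \<omega> + q\<^sup>2" for i \<omega>
    by (auto simp: Y_def B_def power2_eq_square algebra_simps split: split_indicator)
  have indY: "indep_vars (\<lambda>_. borel) Y {1..n}"
    unfolding Y_def B_def by (rule indep_vars_compose2[OF ind]) measurable
  have intY2: "integrable M (\<lambda>\<omega>. (Y i \<omega>)\<^sup>2)" if "i \<in> {1..n}" for i
    unfolding Y2 using B[OF that] by simp
  have expY: "expectation (Y i) = 0" if "i \<in> {1..n}" for i
    unfolding Y_def using B[OF that] by (simp add: prob_space)
  have expY2: "expectation (\<lambda>\<omega>. (Y i \<omega>)\<^sup>2) \<le> q" if "i \<in> {1..n}" for i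
    unfolding Y2 using B[OF that] by (simp add: prob_space power2_eq_square algebra_simps)
  have D_eq: "D = (\<lambda>\<omega>. \<Sum>i\<in>{1..n}. Y i \<omega>)"
  proof
    fix \<omega>
    have "length (indices_above (\<lambda>i. X i \<omega>) (u - t) [1..<n + 1]) = card {i \<in> {1..n}. u - t < X i \<omega>}"
      unfolding indices_above_def by (subst distinct_card[symmetric]) (auto intro!: arg_cong[of _ _ card])
    moreover have "(\<Sum>i\<in>{1..n}. B i \<omega>) = real (card {i \<in> {1..n}. u - t < X i \<omega>})"
      by (simp add: B_eq indicator_def sum.If_cases Int_def conj_commute)
    ultimately show "D \<omega> = (\<Sum>i\<in>{1..n}. Y i \<omega>)"
      by (simp add: D_def Y_def q_def sum_subtractf)
  qed
  have *: "integrable M (\<lambda>\<omega>. (D \<omega>)\<^sup>2)"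
      "expectation (\<lambda>\<omega>. (D \<omega>)\<^sup>2) = (\<Sum>i\<in>{1..n}. expectation (\<lambda>\<omega>. (Y i \<omega>)\<^sup>2))"
    using expectation_square_sum_indep[OF _ indY intY2 expY] by (auto simp: D_eq)
  show "integrable M (\<lambda>\<omega>. (D \<omega>)\<^sup>2)"
    by fact
  show "expectation (\<lambda>\<omega>. (D \<omega>)\<^sup>2) \<le> real n * (t / (u - l))"
    using sum_mono[of "{1..n}", OF expY2] by (simp add: * q_def)
qed

section \<open>Expectation of the pointwise bound\<close>

lemma (in prob_space) michelot_ops_expectation_le:
  fixes X :: "nat \<Rightarrow> 'a \<Rightarrow> real"
  assumes "l < u" and "b > 0" and ind: "indep_vars (\<lambda>_. borel) X {1..n}"
    and unif: "\<And>i. i \<in> {1..n} \<Longrightarrow> distr M borel (X i) = uniform_measure lborel {l..u}"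
  shows "integrable M (\<lambda>\<omega>. real (michelot_ops n (\<lambda>i. X i \<omega>) b))"
    and "expectation (\<lambda>\<omega>. real (michelot_ops n (\<lambda>i. X i \<omega>) b)) \<le>
      7 + (11845 + 2304 * b / (u - l)) * real n"
proof -
  define L where "L = u - l"
  define \<mu> where "\<mu> j = real n / 2 ^ j" for j :: nat
  define D where "D j \<omega> = real (length (indices_above (\<lambda>i. X i \<omega>) (u - L / 2 ^ j) [1..<n + 1])) - \<mu> j"
    for j \<omega>
  have "L > 0" using \<open>l < u\<close> by (simp add: L_def)
  have rv: "random_variable borel (X i)" if "i \<in> {1..n}" for i
    using ind that by (auto simp: indep_vars_def)
  have D: "integrable M (\<lambda>\<omega>. (D j \<omega>)\<^sup>2)" "expectation (\<lambda>\<omega>. (D j \<omega>)\<^sup>2) \<le> \<mu> j" for j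
  proof -
    have t: "0 \<le> L / 2 ^ j" "L / 2 ^ j \<le> u - l"
      using \<open>L > 0\<close> divide_left_mono[of 1 "2 ^ j" L] by (auto simp: L_def)
    have eq: "real n * (L / 2 ^ j / (u - l)) = \<mu> j"
      using \<open>L > 0\<close> by (simp add: L_def \<mu>_def)
    show "integrable M (\<lambda>\<omega>. (D j \<omega>)\<^sup>2)" "expectation (\<lambda>\<omega>. (D j \<omega>)\<^sup>2) \<le> \<mu> j"
      unfolding D_def using uniform_count_deviation[OF \<open>l < u\<close> ind unif t, unfolded eq] by blast+
  qed
  have meas: "(\<lambda>\<omega>. real (michelot_ops n (\<lambda>i. X i \<omega>) b)) \<in> borel_measurable M"
    unfolding michelot_ops_eq
    by (intro measurable_compose[OF measurable_loop_ops[where I = "[1..<n + 1]"]]) (auto intro!: rv)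
  show int: "integrable M (\<lambda>\<omega>. real (michelot_ops n (\<lambda>i. X i \<omega>) b))"
  proof (rule integrable_const_bound[where B = "real (n + (7 + 18 * n\<^sup>2))"])
    show "AE \<omega> in M. norm (real (michelot_ops n (\<lambda>i. X i \<omega>) b)) \<le> real (n + (7 + 18 * n\<^sup>2))"
    proof (intro AE_I2)
      fix \<omega>
      have "michelot_ops n (\<lambda>i. X i \<omega>) b \<le> n + (7 + 18 * n\<^sup>2)"
        using loop_ops_le_square[of "\<lambda>i. X i \<omega>" b "[1..<n + 1]"]
        by (simp add: michelot_ops_eq del: upt_Suc)
      then show "norm (real (michelot_ops n (\<lambda>i. X i \<omega>) b)) \<le> real (n + (7 + 18 * n\<^sup>2))"
        unfolding real_norm_def abs_of_nat of_nat_le_iff .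
    qed
  qed fact

  \<comment> \<open>At scale \<open>j\<close>, reference count times width is
    \<open>n * L / 4 ^ j\<close>. \<open>K\<close> is the first scale where this falls below
    \<open>64 * b\<close>: progress is no longer guaranteed there, but the square of
    \<open>\<mu> K\<close> is already linear in \<open>n\<close>.\<close>
  define K where "K = (LEAST j. real n * L < 64 * b * 4 ^ j)"
  obtain j where "real n * L / (64 * b) < 4 ^ j"
    using real_arch_pow[of 4 "real n * L / (64 * b)"] by auto
  then have "real n * L < 64 * b * 4 ^ j"
    using \<open>b > 0\<close> by (simp add: divide_less_eq mult_ac)
  then have K: "real n * L < 64 * b * 4 ^ K"
    unfolding K_def by (rule LeastI)
  have large: "64 * b * 4 ^ j \<le> real n * L" if "j < K" for j
    using not_less_Least[OF that[unfolded K_def]] by simp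
  have \<mu>K: "(\<mu> K)\<^sup>2 \<le> 64 * b / L * real n"
  proof -
    have "real n / 4 ^ K \<le> 64 * b / L"
      using K \<open>L > 0\<close> by (simp add: divide_le_eq le_divide_eq mult_ac)
    then have "real n * (real n / 4 ^ K) \<le> real n * (64 * b / L)"
      by (rule mult_left_mono) simp
    moreover have "(\<mu> K)\<^sup>2 = real n * (real n / 4 ^ K)"
      by (simp add: \<mu>_def power2_eq_square flip: power_mult_distrib)
    ultimately show ?thesis
      by (simp add: mult_ac)
  qed

  define G where "G \<omega> = real n + (7 + 36 * ((\<mu> K)\<^sup>2 + (D K \<omega>)\<^sup>2) +
    (\<Sum>j=0..<K. 1296 * \<mu> j + 2304 * ((D j \<omega>)\<^sup>2 + (D (j + 2) \<omega>)\<^sup>2)))" for \<omega>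
  \<comment> \<open>The run starts with all indices, whereas the pointwise bound at scale 0 starts
    with those strictly above \<open>l\<close>. The two lists agree almost surely.\<close>
  have "AE \<omega> in M. l < X i \<omega>" if "i \<in> {1..n}" for i
  proof -
    note [measurable] = rv[OF that]
    have "prob {\<omega> \<in> space M. l < X i \<omega>} = 1"
      using prob_uniform_upper_tail[OF \<open>l < u\<close> rv[OF that] unif[OF that], of "u - l"] \<open>l < u\<close> by simp
    then show ?thesis
      by (subst (asm) prob_Collect_eq_1) auto
  qed
  then have "AE \<omega> in M. \<forall>i\<in>{1..n}. l < X i \<omega>"
    by (intro AE_finite_allI) auto
  then have le: "AE \<omega> in M. real (michelot_ops n (\<lambda>i. X i \<omega>) b) \<le> G \<omega>"
  proof eventually_elim
    case (elim \<omega>)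
    have "indices_above (\<lambda>i. X i \<omega>) l [1..<n + 1] = [1..<n + 1]"
      using elim unfolding indices_above_def by (intro filter_True) auto
    then show ?case
      using loop_ops_le_deviations[OF \<open>L > 0\<close> \<open>b > 0\<close> of_nat_0_le_iff large, of K 0 u l "\<lambda>i. X i \<omega>" "[1..<n + 1]"]
      by (simp add: michelot_ops_eq G_def D_def \<mu>_def L_def del: upt_Suc)
  qed

  have intG: "integrable M G"
    unfolding G_def using D(1) by simp
  have "expectation G = real n + (7 + 36 * ((\<mu> K)\<^sup>2 + expectation (\<lambda>\<omega>. (D K \<omega>)\<^sup>2)) +
      (\<Sum>j=0..<K. 1296 * \<mu> j +
        2304 * (expectation (\<lambda>\<omega>. (D j \<omega>)\<^sup>2) + expectation (\<lambda>\<omega>. (D (j + 2) \<omega>)\<^sup>2))))"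
    unfolding G_def using D(1) by (simp add: prob_space)
  \<comment> \<open>Each second moment is at most the mean count, and 5904 = 1296 + 2 *
    2304.\<close>
  also have "\<dots> \<le> real n + (7 + 36 * ((\<mu> K)\<^sup>2 + \<mu> K) + (\<Sum>j=0..<K. 5904 * \<mu> j))"
  proof -
    have "1296 * \<mu> j + 2304 * (expectation (\<lambda>\<omega>. (D j \<omega>)\<^sup>2) + expectation (\<lambda>\<omega>. (D (j + 2) \<omega>)\<^sup>2))
        \<le> 5904 * \<mu> j" for j
    proof -
      have "\<mu> (j + 2) \<le> \<mu> j"
        by (simp add: \<mu>_def field_simps)
      then show ?thesis
        using D(2)[of j] D(2)[of "j + 2"] by argo
    qed
    then show ?thesis
      using D(2)[of K] by (intro add_mono mult_left_mono sum_mono) auto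
  qed
  \<comment> \<open>Geometric sum: the \<open>\<mu> j\<close> with \<open>j < K\<close> add up to
    \<open>2 * (n - \<mu> K)\<close>.\<close>
  also have "(\<Sum>j=0..<K. 5904 * \<mu> j) = 11808 * (real n - \<mu> K)"
  proof (induction K)
    case 0
    then show ?case by (simp add: \<mu>_def)
  next
    case (Suc K)
    moreover have "\<mu> K = 2 * \<mu> (Suc K)"
      by (simp add: \<mu>_def)
    ultimately show ?case by simp
  qed
  also have "real n + (7 + 36 * ((\<mu> K)\<^sup>2 + \<mu> K) + 11808 * (real n - \<mu> K)) \<le>
      7 + 36 * (64 * b / L * real n) + 11809 * real n"
  proof -
    have "\<mu> K \<ge> 0" by (simp add: \<mu>_def)
    with \<mu>K show ?thesis by argo
  qed
  also have "\<dots> \<le> 7 + (11845 + 2304 * b / (u - l)) * real n"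
    by (simp add: L_def algebra_simps)
  finally have "expectation G \<le> 7 + (11845 + 2304 * b / (u - l)) * real n" .
  moreover have "expectation (\<lambda>\<omega>. real (michelot_ops n (\<lambda>i. X i \<omega>) b)) \<le> expectation G"
    by (rule integral_mono_AE[OF int intG le])
  ultimately show "expectation (\<lambda>\<omega>. real (michelot_ops n (\<lambda>i. X i \<omega>) b)) \<le>
      7 + (11845 + 2304 * b / (u - l)) * real n"
    by linarith
qed

theorem proposition2p3:
  fixes l u b :: real
    and M :: "nat \<Rightarrow> 'a measure"
    and d :: "nat \<Rightarrow> nat \<Rightarrow> 'a \<Rightarrow> real"
  assumes "l < u" and "b > 0"
    and "\<And>n. prob_space (M n)"
    and "\<And>n. prob_space.indep_vars (M n) (\<lambda>_. borel) (d n) {1..n}"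
    and "\<And>n i. i \<in> {1..n} \<Longrightarrow> distr (M n) borel (d n i) = uniform_measure lborel {l..u}"
  shows "(\<forall>n. integrable (M n) (\<lambda>\<omega>. real (michelot_ops n (\<lambda>i. d n i \<omega>) b))) \<and>
    (\<lambda>n. prob_space.expectation (M n) (\<lambda>\<omega>. real (michelot_ops n (\<lambda>i. d n i \<omega>) b))) \<in> O(\<lambda>n. real n)"
proof
  note ops = prob_space.michelot_ops_expectation_le[OF assms(3,1,2,4,5)]
  show "\<forall>n. integrable (M n) (\<lambda>\<omega>. real (michelot_ops n (\<lambda>i. d n i \<omega>) b))"
    using ops(1) by blast
  show "(\<lambda>n. prob_space.expectation (M n) (\<lambda>\<omega>. real (michelot_ops n (\<lambda>i. d n i \<omega>) b)))
      \<in> O(\<lambda>n. real n)"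
  proof (rule bigoI)
    \<comment> \<open>For \<open>n\<close> at least 1 the additive 7 is at most
      \<open>7 * n\<close>, whence 11852 = 11845 + 7.\<close>
    show "\<forall>\<^sub>F n in sequentially.
      norm (prob_space.expectation (M n) (\<lambda>\<omega>. real (michelot_ops n (\<lambda>i. d n i \<omega>) b)))
        \<le> (11852 + 2304 * b / (u - l)) * norm (real n)"
      using eventually_ge_at_top[of 1]
    proof eventually_elim
      case (elim n)
      have "0 \<le> prob_space.expectation (M n) (\<lambda>\<omega>. real (michelot_ops n (\<lambda>i. d n i \<omega>) b))"
        by (rule integral_nonneg_AE) simp
      then show ?case
        using ops(2)[of n] elim by (simp add: algebra_simps)
    qed
  qed
qed

end
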